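(* Let $n,b$ be integers with $1\le b\le n$, let $r\in\{1,2,\ldots,b\}$ and $s\in\{0,1,\ldots,n-1\}$, and let $P_{\rm SLP}(\pi(s,r))$ be the winning probability of the single-level policy $\pi(s,r)$. If $0\le s\le r-1$ or $s=n-1$, then $$P_{\rm SLP}(\pi(s,r))=\frac{b}{n}.$$ Otherwise, $$P_{\rm SLP}(\pi(s,r)) = \sum_{i=s+1}^{n-1} \frac{(s)_r}{(i-1)_r}\left( \frac{r}{n} + \frac1n\sum_{j=r+1}^b \sum_{k=1}^r \frac{\binom{j-1}{k-1}\binom{n-j}{i-k}}{\binom{n-1}{i-1}}\right) + \frac{(s)_r}{(n-1)_r}\,\frac{b}{n}.$$
   Context: $n$ objects arrive one by one in uniformly random order. $X_i\in\{1,\ldots,n\}$ is the absolute rank of the $i$-th arriving object (rank 1 is best), so $(X_1,\ldots,X_n)$ is a uniformly random permutation of $\{1,\ldots,n\}$. $Y_i=\#\{k\le i: X_k\le X_i\}$ is the relative rank of the $i$-th object among the first $i$ objects. Single-level policy $\pi(s,r)$ (position threshold $0\le s\le n-1$, rank level $1\le r\le b$): no object at positions $1,\ldots,s$ is picked; the first object at a position $i\in\{s+1,\ldots,n-1\}$ with $Y_i\le r$ is picked; if there is no such object, the last object (position $n$) is picked, whatever its rank. The policy wins if the picked object, at position $i$, has $X_i\le b$ (it is one of the $b$ best). $P_{\rm SLP}(\pi(s,r))$ is the probability of winning. Notation: $(x)_m=x(x-1)\cdots(x-m+1)$ is the falling factorial. Binomial coefficients $\binom{m}{l}$ with $m\ge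 0$ are zero if $l<0$ or $l>m$. Empty sums are zero. *)

theory Defs
  imports "HOL-Probability.Probability" "HOL-Combinatorics.Permutations"
begin

text \<open>
  An arrival order is a permutation \<open>X\<close> of \<open>{1..n}\<close>: \<open>X i\<close> is the absolute rank of the object
  arriving at position \<open>i\<close>, and rank 1 is best.
\<close>

definition arrivals :: "nat \<Rightarrow> (nat \<Rightarrow> nat) pmf" where
  "arrivals n = pmf_of_set {X. X permutes {1..n}}"

definition rel_rank :: "(nat \<Rightarrow> nat) \<Rightarrow> nat \<Rightarrow> nat" where
  "rel_rank X i = card {k \<in> {1..i}. X k \<le> X i}"

definition slp_pick :: "nat \<Rightarrow> nat \<Rightarrow> nat \<Rightarrow> (nat \<Rightarrow> nat) \<Rightarrow> nat" where
  "slp_pick n s r X =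
     (if \<exists>i\<in>{s+1..n-1}. rel_rank X i \<le> r
      then (LEAST i. i \<in> {s+1..n-1} \<and> rel_rank X i \<le> r)
      else n)"

definition P_SLP :: "nat \<Rightarrow> nat \<Rightarrow> nat \<Rightarrow> nat \<Rightarrow> real" where
  "P_SLP n b s r = measure_pmf.prob (arrivals n) {X. X (slp_pick n s r X) \<le> b}"

definition falling_fact :: "'a::comm_ring_1 \<Rightarrow> nat \<Rightarrow> 'a" where
  "falling_fact x m = (\<Prod>k<m. x - of_nat k)"

end

theory Submission
  imports Defs
begin

text \<open>
  The policy picks a position \<open>i\<close> with \<open>s < i < n\<close> exactly when it passes over positions \<open>s+1, \<dots>, i-1\<close> and
  \<open>rel_rank X i \<le> r\<close>, and it falls back to position \<open>n\<close> exactly when it passes over everything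
  up to \<open>n-1\<close>. So the winning probability is a sum over the picked position
  (\<open>P_SLP_decompose\<close>). Whether the policy passes over positions \<open>s+1, \<dots>, m\<close> depends only on the
  relative order of the first \<open>m\<close> objects; both the absolute and the relative rank of a later
  object depend only on which values occupy the first \<open>m\<close> positions and on the values after
  them, not on the order of these first values. In a uniformly random permutation these two
  pieces of information are independent (\<open>prob_initial_pattern_independent\<close>), so each summand
  is a product of two probabilities.

  For \<open>r \<le> s\<close> the first factor, \<open>(s)\<^sub>r / (i-1)\<^sub>r\<close>, is a telescoping product (\<open>prob_no_pick\<close>): the same
  independence shows that the relative rank of each new object is uniform and independent of
  the earlier order, so position \<open>k\<close> is passed over with conditional probability \<open>1 - r/k\<close>.

  The second factor is the probability of \<open>rel_rank X i \<le> r\<close> together with \<open>X i \<le> b\<close>. Given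
  \<open>X i = j\<close>, the first \<open>i-1\<close> objects form a uniformly random \<open>(i-1)\<close>-subset of the other \<open>n-1\<close>
  ranks, and the relative rank is \<open>k\<close> iff \<open>k-1\<close> of them lie below \<open>j\<close>. This hypergeometric law
  (\<open>prob_value_rel_rank\<close>) gives the double sum; the ranks \<open>j \<le> r\<close> contribute \<open>r/n\<close> because a
  relative rank never exceeds the absolute rank.

  If \<open>s < r\<close> or \<open>s = n-1\<close>, the policy always picks position \<open>s+1\<close>, whose absolute rank is uniform.
\<close>

section \<open>Counting arrival orders\<close>

lemma prob_arrivals:
  "measure_pmf.prob (arrivals n) {X. P X} = card {X. X permutes {1..n} \<and> P X} / fact n"
proof -
  have "{X. X permutes {1..n}} \<noteq> {}" using permutes_id by blast
  moreover have "{X. X permutes {1..n}} \<inter> {X. P X} = {X. X permutes {1..n} \<and> P X}" by auto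
  ultimately show ?thesis
    by (simp add: arrivals_def measure_pmf_of_set finite_permutations card_permutations)
qed

lemma prob_arrivals_cong:
  assumes "\<And>X. X permutes {1..n} \<Longrightarrow> P X \<longleftrightarrow> Q X"
  shows "measure_pmf.prob (arrivals n) {X. P X} = measure_pmf.prob (arrivals n) {X. Q X}"
proof -
  have "{X. X permutes {1..n} \<and> P X} = {X. X permutes {1..n} \<and> Q X}" using assms by auto
  then show ?thesis by (simp add: prob_arrivals)
qed

lemma prob_arrivals_disjoint_sum:
  assumes fin: "finite I"
    and cover: "\<And>X. X permutes {1..n} \<Longrightarrow> P X \<longleftrightarrow> (\<exists>i\<in>I. Q i X)"
    and disj: "\<And>X i j. X permutes {1..n} \<Longrightarrow> i \<in> I \<Longrightarrow> j \<in> I \<Longrightarrow> Q i X \<Longrightarrow> Q j X \<Longrightarrow> i = j"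
  shows "measure_pmf.prob (arrivals n) {X. P X} =
    (\<Sum>i\<in>I. measure_pmf.prob (arrivals n) {X. Q i X})"
proof -
  have "{X. X permutes {1..n} \<and> P X} = (\<Union>i\<in>I. {X. X permutes {1..n} \<and> Q i X})"
    using cover by auto
  also have "card \<dots> = (\<Sum>i\<in>I. card {X. X permutes {1..n} \<and> Q i X})"
    by (rule card_UN_disjoint) (use fin disj in \<open>auto simp: finite_permutations\<close>)
  finally show ?thesis by (simp add: prob_arrivals sum_divide_distrib)
qed

lemma prob_arrivals_not:
  "measure_pmf.prob (arrivals n) {X. \<not> P X} = 1 - measure_pmf.prob (arrivals n) {X. P X}"
  using measure_pmf.prob_compl[of "{X. P X}" "arrivals n"]
  by (simp add: set_diff_eq)

lemma card_permutes_compose_left: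
  assumes "\<tau> permutes U"
  shows "card {X. X permutes U \<and> P (\<tau> \<circ> X)} = card {X. X permutes U \<and> P X}"
proof -
  have cancel: "inv \<tau> \<circ> (\<tau> \<circ> X) = X" "\<tau> \<circ> (inv \<tau> \<circ> X) = X" for X :: "'b \<Rightarrow> 'a"
    using permutes_inv_o[OF assms] by (simp_all add: o_assoc)
  have "bij_betw (\<lambda>X. \<tau> \<circ> X) {X. X permutes U \<and> P (\<tau> \<circ> X)} {X. X permutes U \<and> P X}"
    by (rule bij_betw_byWitness[where f' = "\<lambda>X. inv \<tau> \<circ> X"])
      (auto simp: cancel intro!: permutes_compose permutes_inv assms)
  then show ?thesis by (rule bij_betw_same_card)
qed

lemma card_permutes_compose_right:
  assumes "\<sigma> permutes U"
  shows "card {X. X permutes U \<and> P (X \<circ> \<sigma>)} = card {X. X permutes U \<and> P X}"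
proof -
  have cancel: "(X \<circ> \<sigma>) \<circ> inv \<sigma> = X" "(X \<circ> inv \<sigma>) \<circ> \<sigma> = X" for X :: "'a \<Rightarrow> 'b"
    using permutes_inv_o[OF assms] by (simp_all add: o_assoc[symmetric])
  have "bij_betw (\<lambda>X. X \<circ> \<sigma>) {X. X permutes U \<and> P (X \<circ> \<sigma>)} {X. X permutes U \<and> P X}"
    by (rule bij_betw_byWitness[where f' = "\<lambda>X. X \<circ> inv \<sigma>"])
      (auto simp: cancel intro!: permutes_compose permutes_inv assms)
  then show ?thesis by (rule bij_betw_same_card)
qed

lemma prob_arrivals_relabel:
  assumes "\<tau> permutes {1..n}"
  shows "measure_pmf.prob (arrivals n) {X. P (\<tau> \<circ> X)} = measure_pmf.prob (arrivals n) {X. P X}"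
  unfolding prob_arrivals card_permutes_compose_left[OF assms] ..

text \<open>
  Swapping the absolute ranks \<open>j\<close> and \<open>l\<close> preserves the distribution, so the \<open>n\<close> possible values
  of \<open>X i\<close> are equally likely.
\<close>

lemma prob_arrivals_value:
  assumes i: "i \<in> {1..n}" and j: "j \<in> {1..n}"
  shows "measure_pmf.prob (arrivals n) {X. X i = j} = 1 / n"
proof -
  have same: "measure_pmf.prob (arrivals n) {X. X i = l} = measure_pmf.prob (arrivals n) {X. X i = j}"
    if "l \<in> {1..n}" for l
  proof -
    have "(Transposition.transpose j l \<circ> X) i = j \<longleftrightarrow> X i = l" for X :: "nat \<Rightarrow> nat"
      by (auto simp: Transposition.transpose_def split: if_splits)
    then show ?thesis
      using prob_arrivals_relabel[OF permutes_swap_id[OF j that], of "\<lambda>X. X i = j"] by simp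
  qed
  have "1 = measure_pmf.prob (arrivals n) {X. True}" by simp
  also have "\<dots> = (\<Sum>l\<in>{1..n}. measure_pmf.prob (arrivals n) {X. X i = l})"
    by (rule prob_arrivals_disjoint_sum) (use permutes_in_image[of _ "{1..n}" i] i in auto)
  also have "\<dots> = n * measure_pmf.prob (arrivals n) {X. X i = j}"
    using same by simp
  finally show ?thesis using i by (simp add: field_simps)
qed

lemma prob_arrivals_value_le:
  assumes i: "i \<in> {1..n}" and b: "b \<le> n"
  shows "measure_pmf.prob (arrivals n) {X. X i \<le> b} = b / n"
proof -
  have "X i \<in> {1..n}" if "X permutes {1..n}" for X
    using permutes_in_image[OF that] i by blast
  then have "measure_pmf.prob (arrivals n) {X. X i \<le> b}
      = (\<Sum>l\<in>{1..b}. measure_pmf.prob (arrivals n) {X. X i = l})"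
    by (intro prob_arrivals_disjoint_sum) auto
  also have "\<dots> = (\<Sum>l\<in>{1..b}. 1 / n)"
    using b by (intro sum.cong prob_arrivals_value i) auto
  finally show ?thesis by simp
qed

section \<open>Relative order of an initial segment\<close>

text \<open>
  The standardisation of the first \<open>m\<close> entries. It is extended by the identity, so that it is
  itself a permutation of \<open>{1..m}\<close>, and thus a possible outcome of the process with \<open>m\<close> objects.
\<close>

definition pattern :: "nat \<Rightarrow> (nat \<Rightarrow> nat) \<Rightarrow> nat \<Rightarrow> nat" where
  "pattern m X k = (if k \<in> {1..m} then card {l \<in> {1..m}. X l \<le> X k} else k)"

lemma pattern_le_iff:
  assumes "k \<in> {1..m}" "l \<in> {1..m}"
  shows "pattern m X k \<le> pattern m X l \<longleftrightarrow> X k \<le> X l"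
proof
  assume "X k \<le> X l"
  then show "pattern m X k \<le> pattern m X l"
    using assms by (auto simp: pattern_def intro!: card_mono)
next
  assume le: "pattern m X k \<le> pattern m X l"
  show "X k \<le> X l"
  proof (rule ccontr)
    assume "\<not> X k \<le> X l"
    then have "{i \<in> {1..m}. X i \<le> X l} \<subset> {i \<in> {1..m}. X i \<le> X k}"
      using assms by force
    then have "card {i \<in> {1..m}. X i \<le> X l} < card {i \<in> {1..m}. X i \<le> X k}"
      by (rule psubset_card_mono[rotated]) simp
    then show False using le assms by (simp add: pattern_def)
  qed
qed

lemma pattern_permutes:
  assumes "inj_on X {1..m}"
  shows "pattern m X permutes {1..m}"
proof -
  have inj: "inj_on (pattern m X) {1..m}"
    using assms by (intro inj_onI) (metis inj_onD order_antisym order_refl pattern_le_iff)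
  have "pattern m X k \<in> {1..m}" if k: "k \<in> {1..m}" for k
  proof -
    have "card {l \<in> {1..m}. X l \<le> X k} \<le> card {1..m}" by (rule card_mono) auto
    moreover have "card {l \<in> {1..m}. X l \<le> X k} > 0" using k by (auto simp: card_gt_0_iff)
    ultimately show ?thesis using k by (simp add: pattern_def)
  qed
  then have "pattern m X ` {1..m} \<subseteq> {1..m}" by blast
  then have "bij_betw (pattern m X) {1..m} {1..m}"
    using inj endo_inj_surj[of "{1..m}" "pattern m X"] by (simp add: bij_betw_def)
  then show ?thesis by (rule bij_imp_permutes) (auto simp: pattern_def)
qed

text \<open>
  Rearranging the first \<open>m\<close> positions rearranges their pattern in the same way. Hence the patterns
  of all rearrangements of a fixed \<open>X\<close> run once through the permutations of \<open>{1..m}\<close>.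
\<close>

lemma pattern_compose:
  assumes \<sigma>: "\<sigma> permutes {1..m}"
  shows "pattern m (X \<circ> \<sigma>) = pattern m X \<circ> \<sigma>"
proof
  fix k
  show "pattern m (X \<circ> \<sigma>) k = (pattern m X \<circ> \<sigma>) k"
  proof (cases "k \<in> {1..m}")
    case True
    have "{l \<in> {1..m}. X l \<le> X (\<sigma> k)} = \<sigma> ` {l \<in> {1..m}. X (\<sigma> l) \<le> X (\<sigma> k)}" (is "_ = \<sigma> ` ?L")
    proof -
      have "{l \<in> \<sigma> ` {1..m}. X l \<le> X (\<sigma> k)} = \<sigma> ` ?L" by blast
      then show ?thesis unfolding permutes_image[OF \<sigma>] .
    qed
    also have "card \<dots> = card ?L"
      by (rule card_image) (rule permutes_inj_on[OF \<sigma>])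
    finally show ?thesis
      using True permutes_in_image[OF \<sigma>, of k] by (simp add: pattern_def del: atLeastAtMost_iff)
  next
    case False
    then show ?thesis using permutes_not_in[OF \<sigma>] by (auto simp: pattern_def)
  qed
qed

lemma rel_rank_pattern:
  assumes "i \<le> m"
  shows "rel_rank (pattern m X) i = rel_rank X i"
proof -
  have "{k \<in> {1..i}. pattern m X k \<le> pattern m X i} = {k \<in> {1..i}. X k \<le> X i}"
    using assms pattern_le_iff[of _ m i X] by auto
  then show ?thesis by (simp add: rel_rank_def)
qed

text \<open>
  The permutations \<open>\<sigma>\<close> of the first \<open>m\<close> positions act on the arrival orders. The event \<open>R\<close> is
  invariant under this action, whereas the patterns along \<open>X \<circ> \<sigma>\<close> are all permutations of
  \<open>{1..m}\<close>, each once, whatever \<open>X\<close> is. Averaging over \<open>\<sigma>\<close> therefore replaces \<open>Q\<close> by its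
  probability among \<open>m\<close> objects. This gives at once the independence of \<open>Q\<close> and \<open>R\<close> and the fact
  that \<open>Q\<close> is as likely among \<open>n\<close> objects as among \<open>m\<close>.
\<close>

lemma prob_initial_pattern_independent:
  assumes mn: "m \<le> n"
    and Q: "\<And>X. X permutes {1..n} \<Longrightarrow> Q X \<longleftrightarrow> Q (pattern m X)"
    and R: "\<And>X \<sigma>. X permutes {1..n} \<Longrightarrow> \<sigma> permutes {1..m} \<Longrightarrow> R (X \<circ> \<sigma>) \<longleftrightarrow> R X"
  shows "measure_pmf.prob (arrivals n) {X. Q X \<and> R X} =
    measure_pmf.prob (arrivals m) {X. Q X} * measure_pmf.prob (arrivals n) {X. R X}"
proof -
  define Pm where "Pm = {\<sigma>. \<sigma> permutes {1..m}}"
  define Pn where "Pn = {X. X permutes {1..n}}"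
  have fin: "finite Pm" "finite Pn" by (auto simp: Pm_def Pn_def finite_permutations)
  have sub: "\<sigma> permutes {1..n}" if "\<sigma> \<in> Pm" for \<sigma>
    using that mn by (auto simp: Pm_def intro: permutes_subset)
  have shift: "card {\<sigma> \<in> Pm. Q (X \<circ> \<sigma>)} = card {\<sigma> \<in> Pm. Q \<sigma>}" if X: "X \<in> Pn" for X
  proof -
    have inj: "inj_on X {1..m}" using X by (auto simp: Pn_def intro: permutes_inj_on)
    have pat: "pattern m X permutes {1..m}" by (rule pattern_permutes[OF inj])
    have "Q (X \<circ> \<sigma>) \<longleftrightarrow> Q (pattern m X \<circ> \<sigma>)" if "\<sigma> \<in> Pm" for \<sigma>
      using Q[of "X \<circ> \<sigma>"] X sub[OF that] that
      by (simp add: Pm_def Pn_def permutes_compose pattern_compose)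
    then have "{\<sigma> \<in> Pm. Q (X \<circ> \<sigma>)} = {\<sigma>. \<sigma> permutes {1..m} \<and> Q (pattern m X \<circ> \<sigma>)}"
      by (auto simp: Pm_def)
    then show ?thesis using card_permutes_compose_left[OF pat, of Q] by (simp add: Pm_def)
  qed
  \<comment> \<open>Count pairs \<open>(\<sigma>, X)\<close> such that \<open>X \<circ> \<sigma>\<close> satisfies both events, in two ways.\<close>
  have "fact m * card {X \<in> Pn. Q X \<and> R X} = (\<Sum>\<sigma>\<in>Pm. card {X \<in> Pn. Q X \<and> R X})"
    by (simp add: Pm_def card_permutations)
  also have "\<dots> = (\<Sum>\<sigma>\<in>Pm. card {X \<in> Pn. Q (X \<circ> \<sigma>) \<and> R (X \<circ> \<sigma>)})"
    using card_permutes_compose_right[OF sub, of _ "\<lambda>X. Q X \<and> R X"]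
    by (intro sum.cong) (auto simp: Pn_def)
  also have "\<dots> = (\<Sum>\<sigma>\<in>Pm. card {X \<in> Pn. R X \<and> Q (X \<circ> \<sigma>)})"
    using R by (intro sum.cong arg_cong[where f = card]) (auto simp: Pm_def Pn_def)
  also have "\<dots> = (\<Sum>\<sigma>\<in>Pm. card {X \<in> {X \<in> Pn. R X}. Q (X \<circ> \<sigma>)})"
    by (simp add: conj_assoc)
  also have "\<dots> = (\<Sum>X\<in>{X \<in> Pn. R X}. card {\<sigma> \<in> Pm. Q (X \<circ> \<sigma>)})"
    by (rule sum_multicount_gen) (use fin in auto)
  also have "\<dots> = card {X \<in> Pn. R X} * card {\<sigma> \<in> Pm. Q \<sigma>}"
    using shift by simp
  finally have "fact m * card {X \<in> Pn. Q X \<and> R X} = card {X \<in> Pn. R X} * card {\<sigma> \<in> Pm. Q \<sigma>}" .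
  from arg_cong[OF this, of real] have "fact m * real (card {X \<in> Pn. Q X \<and> R X})
      = real (card {X \<in> Pn. R X}) * real (card {\<sigma> \<in> Pm. Q \<sigma>})"
    by (simp only: of_nat_mult of_nat_fact)
  then show ?thesis
    unfolding prob_arrivals Pm_def Pn_def mem_Collect_eq
    by (simp add: field_simps del: One_nat_def)
qed

text \<open>
  The relative rank at \<open>i\<close> depends only on \<open>X i\<close> and the set of earlier values. This form shows
  that it is unchanged when the earlier objects are rearranged, and it reduces its law to
  counting subsets.
\<close>

lemma rel_rank_image:
  assumes inj: "inj_on X {1..i}" and i: "i \<ge> 1"
  shows "rel_rank X i = Suc (card (X ` {1..i-1} \<inter> {..<X i}))"
proof -
  have "X k < X i \<longleftrightarrow> X k \<le> X i" if "k \<in> {1..i-1}" for k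
    using inj_onD[OF inj, of k i] that i by fastforce
  then have "{k \<in> {1..i}. X k \<le> X i} = insert i {k \<in> {1..i-1}. X k < X i}"
    using i by (auto simp: le_less_Suc_eq)
  then have "rel_rank X i = Suc (card {k \<in> {1..i-1}. X k < X i})"
    using i by (simp add: rel_rank_def)
  also have "card {k \<in> {1..i-1}. X k < X i} = card (X ` {k \<in> {1..i-1}. X k < X i})"
    by (rule card_image[symmetric]) (rule inj_on_subset[OF inj], auto)
  also have "X ` {k \<in> {1..i-1}. X k < X i} = X ` {1..i-1} \<inter> {..<X i}" by auto
  finally show ?thesis .
qed

lemma rel_rank_le_value:
  assumes X: "X permutes {1..n}" and i: "i \<in> {1..n}"
  shows "rel_rank X i \<le> X i"
proof -
  have "rel_rank X i = card (X ` {k \<in> {1..i}. X k \<le> X i})"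
    unfolding rel_rank_def by (rule card_image[symmetric]) (rule permutes_inj_on[OF X])
  also have "\<dots> \<le> card {1..X i}"
  proof (rule card_mono)
    have "X ` {1..i} \<subseteq> {1..n}"
      using image_mono[of "{1..i}" "{1..n}" X] permutes_image[OF X] i by simp
    then show "X ` {k \<in> {1..i}. X k \<le> X i} \<subseteq> {1..X i}" by fastforce
  qed simp
  finally show ?thesis by simp
qed

lemma rel_rank_last:
  assumes X: "X permutes {1..n}" and n: "n \<ge> 1"
  shows "rel_rank X n = X n"
proof -
  have "rel_rank X n = card (X ` {k \<in> {1..n}. X k \<le> X n})"
    unfolding rel_rank_def by (rule card_image[symmetric]) (rule permutes_inj_on[OF X])
  also have "X ` {k \<in> {1..n}. X k \<le> X n} = {v \<in> X ` {1..n}. v \<le> X n}" by auto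
  also have "\<dots> = {1..X n}"
    using permutes_image[OF X] permutes_in_image[OF X, of n] n by auto
  finally show ?thesis by simp
qed

section \<open>The probability of passing over every object up to a position\<close>

definition no_pick :: "nat \<Rightarrow> nat \<Rightarrow> nat \<Rightarrow> (nat \<Rightarrow> nat) \<Rightarrow> bool" where
  "no_pick s r m X \<longleftrightarrow> (\<forall>i\<in>{s+1..m}. \<not> rel_rank X i \<le> r)"

lemma no_pick_pattern: "no_pick s r m (pattern m X) \<longleftrightarrow> no_pick s r m X"
  by (simp add: no_pick_def rel_rank_pattern)

text \<open>
  Both sides are \<open>(x+1)\<^sub>r\<^sub>+\<^sub>1\<close>. This is what makes the product of the factors \<open>1 - r/k\<close> telescope.
\<close>

lemma falling_fact_shift:
  fixes x :: "'a::comm_ring_1"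
  shows "falling_fact (x + 1) r * (x + 1 - of_nat r) = (x + 1) * falling_fact x r"
proof -
  have "falling_fact (x + 1) r * (x + 1 - of_nat r) = (\<Prod>k<Suc r. x + 1 - of_nat k)"
    by (simp add: falling_fact_def)
  also have "\<dots> = (x + 1) * falling_fact x r"
    by (subst prod.lessThan_Suc_shift) (simp add: falling_fact_def)
  finally show ?thesis .
qed

lemma falling_fact_pos:
  assumes "r \<le> m"
  shows "falling_fact (real m) r > 0"
  unfolding falling_fact_def by (rule prod_pos) (use assms in auto)

text \<open>
  Induction on \<open>m\<close>: the relative rank of the last of \<open>m+1\<close> objects is its absolute rank, which is
  uniform on \<open>{1..m+1}\<close> and, by \<open>prob_initial_pattern_independent\<close>, independent of the order of
  the first \<open>m\<close>. So the probability gains the factor \<open>1 - r/(m+1)\<close>. The hypothesis \<open>r \<le> s\<close> keeps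
  the falling factorials in the denominators positive.
\<close>

lemma prob_no_pick:
  assumes "r \<le> s" "s \<le> m"
  shows "measure_pmf.prob (arrivals m) {X. no_pick s r m X} =
    falling_fact (real s) r / falling_fact (real m) r"
  using assms(2)
proof (induction m rule: dec_induct)
  case base
  have "{X. no_pick s r s X} = UNIV" by (simp add: no_pick_def)
  then show ?case using falling_fact_pos[OF assms(1)] by simp
next
  case (step m)
  have "measure_pmf.prob (arrivals (Suc m)) {X. no_pick s r (Suc m) X}
      = measure_pmf.prob (arrivals (Suc m)) {X. no_pick s r m X \<and> \<not> X (Suc m) \<le> r}"
  proof (rule prob_arrivals_cong)
    fix X assume "X permutes {1..Suc m}"
    then have "rel_rank X (Suc m) = X (Suc m)" by (rule rel_rank_last) simp
    moreover have "{s+1..Suc m} = insert (Suc m) {s+1..m}" using step by auto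
    ultimately show "no_pick s r (Suc m) X \<longleftrightarrow> no_pick s r m X \<and> \<not> X (Suc m) \<le> r"
      by (auto simp: no_pick_def)
  qed
  also have "\<dots> = measure_pmf.prob (arrivals m) {X. no_pick s r m X}
      * measure_pmf.prob (arrivals (Suc m)) {X. \<not> X (Suc m) \<le> r}"
    by (rule prob_initial_pattern_independent) (auto simp: no_pick_pattern permutes_not_in)
  also have "measure_pmf.prob (arrivals (Suc m)) {X. \<not> X (Suc m) \<le> r} = 1 - r / Suc m"
    using assms(1) step by (subst prob_arrivals_not, subst prob_arrivals_value_le) auto
  also have "measure_pmf.prob (arrivals m) {X. no_pick s r m X} * (1 - r / Suc m)
      = falling_fact (real s) r / falling_fact (real (Suc m)) r"
  proof -
    have "falling_fact (real m) r > 0" "falling_fact (real (Suc m)) r > 0"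
      using assms(1) step by (auto intro!: falling_fact_pos simp del: of_nat_Suc)
    moreover have "falling_fact (real (Suc m)) r * (real (Suc m) - real r)
        = real (Suc m) * falling_fact (real m) r"
      using falling_fact_shift[of "real m" r] by (simp add: add.commute)
    ultimately have "(1 - r / Suc m) / falling_fact (real m) r = 1 / falling_fact (real (Suc m)) r"
      by (simp add: divide_simps del: of_nat_Suc) (simp add: mult.commute del: of_nat_Suc)
    then show ?thesis using step.IH by (metis (no_types) mult.commute times_divide_eq_left times_divide_eq_right mult_1)
  qed
  finally show ?case .
qed

section \<open>The joint law of absolute and relative rank\<close>

lemma ex_permutes_image_eq:
  assumes V: "finite V" and S: "S \<subseteq> V" "S' \<subseteq> V" and card: "card S = card S'"
  shows "\<exists>\<tau>. \<tau> permutes V \<and> \<tau> ` S = S'"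
proof -
  have fin: "finite S" "finite S'" using V S finite_subset by auto
  obtain f where f: "bij_betw f S S'" using finite_same_card_bij[OF fin card] by blast
  have "card (V - S) = card (V - S')" using S fin card by (simp add: card_Diff_subset)
  then obtain g where g: "bij_betw g (V - S) (V - S')"
    using finite_same_card_bij[of "V - S" "V - S'"] V by auto
  define \<tau> where "\<tau> x = (if x \<in> S then f x else if x \<in> V then g x else x)" for x
  have on_S: "bij_betw \<tau> S S'" using f by (rule bij_betw_cong[THEN iffD1, rotated]) (simp add: \<tau>_def)
  moreover have "bij_betw \<tau> (V - S) (V - S')"
    using g by (rule bij_betw_cong[THEN iffD1, rotated]) (simp add: \<tau>_def)
  ultimately have "bij_betw \<tau> (S \<union> (V - S)) (S' \<union> (V - S'))" by (rule bij_betw_combine) auto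
  moreover have "S \<union> (V - S) = V" "S' \<union> (V - S') = V" using S by auto
  ultimately have "\<tau> permutes V" using S by (intro bij_imp_permutes) (auto simp: \<tau>_def)
  then show ?thesis using on_S by (auto simp: bij_betw_def)
qed

text \<open>
  Given \<open>X i = j\<close>, the set of values at the positions \<open>A\<close> is uniform among the subsets of the
  other ranks of the right size: a relabelling of the ranks that fixes \<open>j\<close> moves any such set to
  any other one.
\<close>

lemma prob_arrivals_value_image:
  assumes i: "i \<in> {1..n}" and j: "j \<in> {1..n}" and A: "A \<subseteq> {1..n} - {i}"
    and S: "S \<subseteq> {1..n} - {j}" "card S = card A"
  shows "measure_pmf.prob (arrivals n) {X. X i = j \<and> X ` A = S} =
    1 / (n * ((n - 1) choose card A))"
proof -
  let ?V = "{1..n} - {j}"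
  define F where "F = {T. T \<subseteq> ?V \<and> card T = card A}"
  have finF: "finite F" by (simp add: F_def)
  have cardF: "card F = (n - 1) choose card A"
    using n_subsets[of ?V "card A"] j by (simp add: F_def)
  have S_in: "S \<in> F" using S by (simp add: F_def)
  have same: "measure_pmf.prob (arrivals n) {X. X i = j \<and> X ` A = T}
      = measure_pmf.prob (arrivals n) {X. X i = j \<and> X ` A = S}" if T: "T \<in> F" for T
  proof -
    obtain \<tau> where \<tau>: "\<tau> permutes ?V" "\<tau> ` T = S"
      using ex_permutes_image_eq[of ?V T S] T S by (auto simp: F_def)
    have fix_j: "\<tau> j = j" using permutes_not_in[OF \<tau>(1)] by simp
    have inj: "inj \<tau>" using permutes_inj[OF \<tau>(1)] .
    have "(\<tau> \<circ> X) i = j \<and> (\<tau> \<circ> X) ` A = S \<longleftrightarrow> X i = j \<and> X ` A = T" for X :: "nat \<Rightarrow> nat"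
      using inj_eq[OF inj, of "X i" j] inj_image_eq_iff[OF inj, of "X ` A" T] fix_j \<tau>(2)
      by (simp add: image_image)
    moreover have "\<tau> permutes {1..n}" using \<tau>(1) by (rule permutes_subset) auto
    ultimately show ?thesis
      using prob_arrivals_relabel[of \<tau> n "\<lambda>X. X i = j \<and> X ` A = S"] by simp
  qed
  have "1 / n = measure_pmf.prob (arrivals n) {X. X i = j}"
    using prob_arrivals_value[OF i j] by simp
  also have "\<dots> = (\<Sum>T\<in>F. measure_pmf.prob (arrivals n) {X. X i = j \<and> X ` A = T})"
  proof (rule prob_arrivals_disjoint_sum[OF finF])
    fix X assume X: "X permutes {1..n}"
    have "X ` A \<in> F" if ij: "X i = j"
    proof -
      have "X ` A \<subseteq> ?V"
        using A ij permutes_in_image[OF X] inj_eq[OF permutes_inj[OF X], of _ i] by fastforce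
      then show ?thesis using card_image[OF permutes_inj_on[OF X], of A] by (simp add: F_def)
    qed
    then show "X i = j \<longleftrightarrow> (\<exists>T\<in>F. X i = j \<and> X ` A = T)" by auto
  qed auto
  also have "\<dots> = card F * measure_pmf.prob (arrivals n) {X. X i = j \<and> X ` A = S}"
    using same by simp
  finally have "1 / n = ((n - 1) choose card A) * measure_pmf.prob (arrivals n) {X. X i = j \<and> X ` A = S}"
    by (simp add: cardF)
  moreover have "((n - 1) choose card A) > 0"
    using S_in finF cardF by (metis card_gt_0_iff empty_iff)
  ultimately show ?thesis using i by (simp add: field_simps)
qed

lemma card_subsets_split:
  assumes fin: "finite A" "finite B" and disj: "A \<inter> B = {}"
  shows "card {S. S \<subseteq> A \<union> B \<and> card (S \<inter> A) = a \<and> card S = a + c} =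
    (card A choose a) * (card B choose c)"
proof -
  have "card {S. S \<subseteq> A \<union> B \<and> card (S \<inter> A) = a \<and> card S = a + c}
      = card ({S. S \<subseteq> A \<and> card S = a} \<times> {S. S \<subseteq> B \<and> card S = c})"
  proof (rule bij_betw_same_card[of "\<lambda>S. (S \<inter> A, S \<inter> B)"],
      rule bij_betw_byWitness[where f' = "\<lambda>(S, T). S \<union> T"])
    have "card S = card (S \<inter> A) + card (S \<inter> B)" if "S \<subseteq> A \<union> B" for S
    proof -
      have "S = (S \<inter> A) \<union> (S \<inter> B)" using that by auto
      then show ?thesis using fin disj card_Un_disjoint[of "S \<inter> A" "S \<inter> B"] by auto
    qed
    then show "(\<lambda>S. (S \<inter> A, S \<inter> B)) ` {S. S \<subseteq> A \<union> B \<and> card (S \<inter> A) = a \<and> card S = a + c}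
        \<subseteq> {S. S \<subseteq> A \<and> card S = a} \<times> {S. S \<subseteq> B \<and> card S = c}" by auto
    show "(\<lambda>(S, T). S \<union> T) ` ({S. S \<subseteq> A \<and> card S = a} \<times> {S. S \<subseteq> B \<and> card S = c})
        \<subseteq> {S. S \<subseteq> A \<union> B \<and> card (S \<inter> A) = a \<and> card S = a + c}"
    proof (rule image_subsetI)
      fix p assume p: "p \<in> {S. S \<subseteq> A \<and> card S = a} \<times> {S. S \<subseteq> B \<and> card S = c}"
      then obtain S T where ST: "p = (S, T)" "S \<subseteq> A" "card S = a" "T \<subseteq> B" "card T = c" by auto
      then have "(S \<union> T) \<inter> A = S" "finite S" "finite T" "S \<inter> T = {}"
        using disj fin finite_subset by auto
      then show "(\<lambda>(S, T). S \<union> T) p \<in> {S. S \<subseteq> A \<union> B \<and> card (S \<inter> A) = a \<and> card S = a + c}"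
        using ST by (auto simp: card_Un_disjoint)
    qed
  qed (use disj in auto)
  then show ?thesis using fin by (simp add: n_subsets card_cartesian_product)
qed

text \<open>
  Relative rank \<open>k\<close> for \<open>X i = j\<close> means that \<open>k-1\<close> of the \<open>i-1\<close> earlier values lie below \<open>j\<close> and the
  other \<open>i-k\<close> above it. The earlier values form a uniform subset, so it remains to count the
  subsets that split in this way.
\<close>

lemma prob_value_rel_rank:
  assumes i: "i \<in> {1..n}" and j: "j \<in> {1..n}" and k: "k \<in> {1..i}"
  shows "measure_pmf.prob (arrivals n) {X. X i = j \<and> rel_rank X i = k} =
    1 / n * (((j - 1) choose (k - 1)) * ((n - j) choose (i - k)) / ((n - 1) choose (i - 1)))"
proof -
  let ?A = "{1..i-1}" and ?B = "{1..j-1}"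
  define F where "F = {S. S \<subseteq> ?B \<union> {j+1..n} \<and> card (S \<inter> ?B) = k - 1 \<and> card S = (k - 1) + (i - k)}"
  have V: "?B \<union> {j+1..n} = {1..n} - {j}" using j by auto
  have finF: "finite F" by (simp add: F_def)
  have cardF: "card F = ((j - 1) choose (k - 1)) * ((n - j) choose (i - k))"
    unfolding F_def by (subst card_subsets_split) auto
  have "measure_pmf.prob (arrivals n) {X. X i = j \<and> rel_rank X i = k}
      = (\<Sum>S\<in>F. measure_pmf.prob (arrivals n) {X. X i = j \<and> X ` ?A = S})"
  proof (rule prob_arrivals_disjoint_sum[OF finF])
    fix X assume X: "X permutes {1..n}"
    have "rel_rank X i = k \<longleftrightarrow> X ` ?A \<in> F" if ij: "X i = j"
    proof -
      have sub: "X ` ?A \<subseteq> {1..n} - {j}"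
        using i ij permutes_in_image[OF X] inj_eq[OF permutes_inj[OF X], of _ i] by fastforce
      then have "X ` ?A \<inter> {..<j} = X ` ?A \<inter> ?B" by fastforce
      then have rank: "rel_rank X i = Suc (card (X ` ?A \<inter> ?B))"
        using rel_rank_image[OF permutes_inj_on[OF X], of i] i ij by simp
      have "card (X ` ?A) = (k - 1) + (i - k)"
        using card_image[OF permutes_inj_on[OF X], of ?A] k by simp
      then have "X ` ?A \<in> F \<longleftrightarrow> card (X ` ?A \<inter> ?B) = k - 1"
        using sub unfolding F_def V by blast
      then show ?thesis using rank k by auto
    qed
    then show "X i = j \<and> rel_rank X i = k \<longleftrightarrow> (\<exists>S\<in>F. X i = j \<and> X ` ?A = S)" by blast
  qed auto
  also have "\<dots> = (\<Sum>S\<in>F. 1 / (n * ((n - 1) choose card ?A)))"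
  proof (intro sum.cong refl prob_arrivals_value_image i j)
    show "?A \<subseteq> {1..n} - {i}" using i by auto
    fix S assume "S \<in> F"
    then show "S \<subseteq> {1..n} - {j}" "card S = card ?A" using V k by (auto simp: F_def)
  qed
  finally show ?thesis by (simp add: cardF)
qed

text \<open>
  For \<open>X i \<le> r\<close> the condition on the relative rank holds automatically, which gives the summand
  \<open>r/n\<close> without binomial coefficients.
\<close>

lemma prob_rel_rank_le_value_le:
  assumes i: "i \<in> {1..n}" and r: "r \<le> b" "r \<le> i" and b: "b \<le> n"
  shows "measure_pmf.prob (arrivals n) {X. rel_rank X i \<le> r \<and> X i \<le> b} =
    r / n + 1 / n * (\<Sum>j=r+1..b. \<Sum>k=1..r.
      real ((j - 1) choose (k - 1)) * real ((n - j) choose (i - k)) / real ((n - 1) choose (i - 1)))"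
proof -
  let ?prob = "measure_pmf.prob (arrivals n)"
  have "X i \<in> {1..n}" if "X permutes {1..n}" for X
    using permutes_in_image[OF that] i by blast
  then have "?prob {X. rel_rank X i \<le> r \<and> X i \<le> b}
      = (\<Sum>j\<in>{1..b}. ?prob {X. X i = j \<and> rel_rank X i \<le> r})"
    by (intro prob_arrivals_disjoint_sum) auto
  also have "{1..b} = {1..r} \<union> {r+1..b}" using r by auto
  also have "(\<Sum>j\<in>{1..r} \<union> {r+1..b}. ?prob {X. X i = j \<and> rel_rank X i \<le> r})
      = (\<Sum>j=1..r. ?prob {X. X i = j \<and> rel_rank X i \<le> r})
      + (\<Sum>j=r+1..b. ?prob {X. X i = j \<and> rel_rank X i \<le> r})"
    by (rule sum.union_disjoint) auto
  also have "(\<Sum>j=1..r. ?prob {X. X i = j \<and> rel_rank X i \<le> r}) = (\<Sum>j=1..r. 1 / n)"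
  proof (rule sum.cong)
    fix j assume j: "j \<in> {1..r}"
    have "?prob {X. X i = j \<and> rel_rank X i \<le> r} = ?prob {X. X i = j}"
    proof (rule prob_arrivals_cong)
      fix X assume "X permutes {1..n}"
      then have "rel_rank X i \<le> X i" using i by (rule rel_rank_le_value)
      then show "X i = j \<and> rel_rank X i \<le> r \<longleftrightarrow> X i = j" using j by auto
    qed
    then show "?prob {X. X i = j \<and> rel_rank X i \<le> r} = 1 / n"
      using prob_arrivals_value[OF i, of j] j r b by simp
  qed simp
  also have "(\<Sum>j=r+1..b. ?prob {X. X i = j \<and> rel_rank X i \<le> r})
      = (\<Sum>j=r+1..b. \<Sum>k=1..r. ?prob {X. X i = j \<and> rel_rank X i = k})"
  proof (intro sum.cong refl prob_arrivals_disjoint_sum)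
    fix X j assume X: "X permutes {1..n}"
    have "rel_rank X i \<ge> 1" using rel_rank_image[OF permutes_inj_on[OF X], of i] i by simp
    then show "X i = j \<and> rel_rank X i \<le> r \<longleftrightarrow> (\<exists>k\<in>{1..r}. X i = j \<and> rel_rank X i = k)" by auto
  qed auto
  also have "\<dots> = (\<Sum>j=r+1..b. \<Sum>k=1..r. 1 / n *
      (real ((j - 1) choose (k - 1)) * real ((n - j) choose (i - k)) / real ((n - 1) choose (i - 1))))"
  proof (intro sum.cong refl)
    fix j k assume "j \<in> {r+1..b}" "k \<in> {1..r}"
    then have "j \<in> {1..n}" "k \<in> {1..i}" using r b by auto
    from prob_value_rel_rank[OF i this]
    show "?prob {X. X i = j \<and> rel_rank X i = k} = 1 / n *
      (real ((j - 1) choose (k - 1)) * real ((n - j) choose (i - k)) / real ((n - 1) choose (i - 1)))"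
      by (simp only: of_nat_mult)
  qed
  finally show ?thesis by (simp add: sum_distrib_left)
qed

section \<open>The winning probability\<close>

lemma slp_pick_eqI:
  assumes "i \<in> {s+1..n-1}" "rel_rank X i \<le> r" "no_pick s r (i - 1) X"
  shows "slp_pick n s r X = i"
proof -
  have "(LEAST i. i \<in> {s+1..n-1} \<and> rel_rank X i \<le> r) = i"
  proof (rule Least_equality)
    fix l assume l: "l \<in> {s+1..n-1} \<and> rel_rank X l \<le> r"
    then have "l \<notin> {s+1..i-1}" using assms(3) unfolding no_pick_def by blast
    then show "i \<le> l" using l by auto
  qed (use assms in auto)
  then show ?thesis using assms by (auto simp: slp_pick_def)
qed

lemma slp_pick_last:
  assumes "no_pick s r (n - 1) X"
  shows "slp_pick n s r X = n"
proof -
  have "\<not> (\<exists>i\<in>{s+1..n-1}. rel_rank X i \<le> r)"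
    using assms unfolding no_pick_def by blast
  then show ?thesis unfolding slp_pick_def by (rule if_not_P)
qed

lemma slp_pick_cases:
  obtains (inner) i where "i \<in> {s+1..n-1}" "rel_rank X i \<le> r" "no_pick s r (i - 1) X"
    | (last) "no_pick s r (n - 1) X" "slp_pick n s r X = n"
proof (cases "no_pick s r (n - 1) X")
  case True
  then show ?thesis by (intro last slp_pick_last)
next
  case False
  define P where "P i \<longleftrightarrow> i \<in> {s+1..n-1} \<and> rel_rank X i \<le> r" for i
  have "\<exists>i. P i" using False unfolding no_pick_def P_def by blast
  then obtain i where i: "P i" "\<And>l. l < i \<Longrightarrow> \<not> P l"
    using exists_least_iff[of P] by blast
  have "no_pick s r (i - 1) X" unfolding no_pick_def
  proof
    fix l assume "l \<in> {s+1..i-1}"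
    then have "l < i" "l \<in> {s+1..n-1}" using i(1) by (auto simp: P_def)
    then show "\<not> rel_rank X l \<le> r" using i(2) unfolding P_def by blast
  qed
  then show ?thesis using inner i(1) unfolding P_def by blast
qed

text \<open>
  The summands are the probabilities of winning with the object at position \<open>i\<close>, where the last
  one stands for the fallback to position \<open>n\<close>.
\<close>

lemma P_SLP_decompose:
  assumes n: "1 \<le> n"
  shows "P_SLP n b s r =
    (\<Sum>i=s+1..n-1. measure_pmf.prob (arrivals n)
       {X. no_pick s r (i - 1) X \<and> rel_rank X i \<le> r \<and> X i \<le> b})
    + measure_pmf.prob (arrivals n) {X. no_pick s r (n - 1) X \<and> X n \<le> b}"
proof -
  \<comment> \<open>Winning at position \<open>i\<close>; the fallback to \<open>n\<close> picks the object whatever its rank.\<close>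
  define W where "W i X \<longleftrightarrow> (if i = n then no_pick s r (n - 1) X \<and> X n \<le> b
      else no_pick s r (i - 1) X \<and> rel_rank X i \<le> r \<and> X i \<le> b)" for i X
  have pick: "slp_pick n s r X = i" if "i \<in> insert n {s+1..n-1}" "W i X" for i X
  proof (cases "i = n")
    case True
    then show ?thesis using that by (auto simp: W_def intro: slp_pick_last)
  next
    case False
    then show ?thesis using that by (intro slp_pick_eqI) (auto simp: W_def)
  qed
  have "P_SLP n b s r = (\<Sum>i\<in>insert n {s+1..n-1}. measure_pmf.prob (arrivals n) {X. W i X})"
    unfolding P_SLP_def
  proof (rule prob_arrivals_disjoint_sum)
    fix X
    show "X (slp_pick n s r X) \<le> b \<longleftrightarrow> (\<exists>i\<in>insert n {s+1..n-1}. W i X)"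
    proof
      assume win: "X (slp_pick n s r X) \<le> b"
      show "\<exists>i\<in>insert n {s+1..n-1}. W i X"
      proof (cases rule: slp_pick_cases[of s n X r])
        case (inner i)
        then have "W i X" using win slp_pick_eqI[OF inner] n by (auto simp: W_def)
        then show ?thesis using inner by blast
      next
        case last
        then show ?thesis using win by (simp add: W_def)
      qed
    next
      assume "\<exists>i\<in>insert n {s+1..n-1}. W i X"
      then obtain i where i: "i \<in> insert n {s+1..n-1}" "W i X" by blast
      then have "X i \<le> b" by (auto simp: W_def split: if_splits)
      then show "X (slp_pick n s r X) \<le> b" using pick[OF i] by simp
    qed
  next
    fix X i j
    assume "i \<in> insert n {s+1..n-1}" "j \<in> insert n {s+1..n-1}" "W i X" "W j X"
    then show "i = j" using pick by metis
  qed simp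
  also have "\<dots> = (\<Sum>i=s+1..n-1. measure_pmf.prob (arrivals n) {X. W i X})
      + measure_pmf.prob (arrivals n) {X. W n X}"
    using n by (subst sum.insert) auto
  also have "(\<Sum>i=s+1..n-1. measure_pmf.prob (arrivals n) {X. W i X}) =
      (\<Sum>i=s+1..n-1. measure_pmf.prob (arrivals n)
       {X. no_pick s r (i - 1) X \<and> rel_rank X i \<le> r \<and> X i \<le> b})"
  proof (intro sum.cong refl)
    fix i assume "i \<in> {s+1..n-1}"
    then have "i \<noteq> n" by auto
    then show "measure_pmf.prob (arrivals n) {X. W i X} = measure_pmf.prob (arrivals n)
        {X. no_pick s r (i - 1) X \<and> rel_rank X i \<le> r \<and> X i \<le> b}"
      by (simp add: W_def)
  qed
  finally show ?thesis by (simp add: W_def)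
qed

text \<open>
  In both cases position \<open>s+1\<close> is always picked: if \<open>s < r\<close>, its relative rank is at most
  \<open>s+1 \<le> r\<close>; if \<open>s = n-1\<close>, it is the last position.
\<close>

lemma P_SLP_fixed_position:
  assumes b: "b \<le> n" and s: "s < n" "s < r \<or> s = n - 1"
  shows "P_SLP n b s r = b / n"
proof -
  have "slp_pick n s r X = s + 1" if X: "X permutes {1..n}" for X
  proof (cases "s = n - 1")
    case True
    then show ?thesis using s by (simp add: slp_pick_def)
  next
    case False
    have "rel_rank X (s + 1) \<le> card {1..s+1}"
      unfolding rel_rank_def by (rule card_mono) auto
    then show ?thesis using False s by (intro slp_pick_eqI) (auto simp: no_pick_def)
  qed
  then have "P_SLP n b s r = measure_pmf.prob (arrivals n) {X. X (s + 1) \<le> b}"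
    unfolding P_SLP_def by (intro prob_arrivals_cong) simp
  also have "\<dots> = b / n" using s b by (intro prob_arrivals_value_le) auto
  finally show ?thesis .
qed

lemma P_SLP_formula:
  assumes r: "r \<le> b" "r \<le> s" and b: "b \<le> n" and s: "s < n"
  shows "P_SLP n b s r =
        (\<Sum>i=s+1..n-1.
           falling_fact (real s) r / falling_fact (real (i - 1)) r *
           (real r / real n +
            1 / real n *
              (\<Sum>j=r+1..b. \<Sum>k=1..r.
                 real ((j - 1) choose (k - 1)) * real ((n - j) choose (i - k)) /
                 real ((n - 1) choose (i - 1)))))
        + falling_fact (real s) r / falling_fact (real (n - 1)) r * (real b / real n)"
proof -
  have inner: "measure_pmf.prob (arrivals n)
       {X. no_pick s r (i - 1) X \<and> rel_rank X i \<le> r \<and> X i \<le> b} =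
      falling_fact (real s) r / falling_fact (real (i - 1)) r *
           (real r / real n + 1 / real n *
              (\<Sum>j=r+1..b. \<Sum>k=1..r.
                 real ((j - 1) choose (k - 1)) * real ((n - j) choose (i - k)) /
                 real ((n - 1) choose (i - 1))))" if i: "i \<in> {s+1..n-1}" for i
  proof -
    have "measure_pmf.prob (arrivals n)
        {X. no_pick s r (i - 1) X \<and> rel_rank X i \<le> r \<and> X i \<le> b} =
        measure_pmf.prob (arrivals (i - 1)) {X. no_pick s r (i - 1) X} *
        measure_pmf.prob (arrivals n) {X. rel_rank X i \<le> r \<and> X i \<le> b}"
      \<comment> \<open>Rearranging the first \<open>i-1\<close> objects fixes \<open>X i\<close> and the set of earlier values.\<close>
    proof (rule prob_initial_pattern_independent)
      fix X \<sigma> assume X: "X permutes {1..n}" and \<sigma>: "\<sigma> permutes {1..i - 1}"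
      have inj: "inj (X \<circ> \<sigma>)" using permutes_inj[OF X] permutes_inj[OF \<sigma>] by (rule inj_compose)
      have fix_i: "\<sigma> i = i" using permutes_not_in[OF \<sigma>, of i] i by auto
      have "(X \<circ> \<sigma>) ` {1..i-1} = X ` {1..i-1}"
        using permutes_image[OF \<sigma>] by (simp only: image_comp[symmetric])
      then have "rel_rank (X \<circ> \<sigma>) i = rel_rank X i"
        using rel_rank_image[OF inj_on_subset[OF inj], of i] i fix_i
          rel_rank_image[OF permutes_inj_on[OF X], of i] by simp
      then show "rel_rank (X \<circ> \<sigma>) i \<le> r \<and> (X \<circ> \<sigma>) i \<le> b \<longleftrightarrow> rel_rank X i \<le> r \<and> X i \<le> b"
        using fix_i by simp
    qed (use i in \<open>auto simp: no_pick_pattern\<close>)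
    moreover have "measure_pmf.prob (arrivals (i - 1)) {X. no_pick s r (i - 1) X}
        = falling_fact (real s) r / falling_fact (real (i - 1)) r"
      using i r by (intro prob_no_pick) auto
    moreover have "i \<in> {1..n}" "r \<le> i" using i r by auto
    ultimately show ?thesis
      using prob_rel_rank_le_value_le[of i n r b] r b by simp
  qed
  have "measure_pmf.prob (arrivals n) {X. no_pick s r (n - 1) X \<and> X n \<le> b} =
      measure_pmf.prob (arrivals (n - 1)) {X. no_pick s r (n - 1) X} *
      measure_pmf.prob (arrivals n) {X. X n \<le> b}"
    using s by (intro prob_initial_pattern_independent) (auto simp: no_pick_pattern permutes_not_in)
  also have "\<dots> = falling_fact (real s) r / falling_fact (real (n - 1)) r * (real b / real n)"
    using prob_no_pick[of r s "n - 1"] prob_arrivals_value_le[of n n b] r b s by simp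
  finally have last: "measure_pmf.prob (arrivals n) {X. no_pick s r (n - 1) X \<and> X n \<le> b} =
      falling_fact (real s) r / falling_fact (real (n - 1)) r * (real b / real n)" .
  have n: "1 \<le> n" using s by simp
  show ?thesis
    unfolding P_SLP_decompose[OF n] last by (intro arg_cong2[where f = "(+)"] sum.cong refl inner)
qed

theorem theorem1:
  fixes n b r s :: nat
  assumes "1 \<le> b" and "b \<le> n"
    and "r \<in> {1..b}"
    and "s \<in> {0..n-1}"
  shows "(s \<le> r - 1 \<or> s = n - 1 \<longrightarrow> P_SLP n b s r = real b / real n) \<and>
    (\<not> (s \<le> r - 1 \<or> s = n - 1) \<longrightarrow>
      P_SLP n b s r =
        (\<Sum>i=s+1..n-1.
           falling_fact (real s) r / falling_fact (real (i - 1)) r *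
           (real r / real n +
            1 / real n *
              (\<Sum>j=r+1..b. \<Sum>k=1..r.
                 real ((j - 1) choose (k - 1)) * real ((n - j) choose (i - k)) /
                 real ((n - 1) choose (i - 1)))))
        + falling_fact (real s) r / falling_fact (real (n - 1)) r * (real b / real n))"
proof (intro conjI impI)
  assume "s \<le> r - 1 \<or> s = n - 1"
  then show "P_SLP n b s r = real b / real n"
    using assms by (intro P_SLP_fixed_position) auto
next
  assume "\<not> (s \<le> r - 1 \<or> s = n - 1)"
  then show "P_SLP n b s r = (\<Sum>i=s+1..n-1.
           falling_fact (real s) r / falling_fact (real (i - 1)) r *
           (real r / real n + 1 / real n * (\<Sum>j=r+1..b. \<Sum>k=1..r.
                 real ((j - 1) choose (k - 1)) * real ((n - j) choose (i - k)) /
                 real ((n - 1) choose (i - 1)))))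
        + falling_fact (real s) r / falling_fact (real (n - 1)) r * (real b / real n)"
    using assms by (intro P_SLP_formula) auto
qed

end
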